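(* Let $n\ge 1$, $N\ge 1$, and let $V_X\in C^2(\mathbb{R})$ be a real-valued function for each $X\in\mathbb{Z}^n$. Assume that $$k_1:=\inf_{X\in\mathbb{Z}^n,\ \lambda\ge 0}\partial_\lambda V_X(\lambda)>-\infty.$$ Define $\tau_1=\sqrt{-1/k_1}$ if $k_1<0$ and $\tau_1=+\infty$ if $k_1\ge 0$. Then for any $\tau\in(0,\tau_1)$, any $\varepsilon>0$, and arbitrary initial data $\psi^0,\psi^1:\mathbb{Z}^n\to\mathbb{C}^N$, there exists a global solution $\psi^T$, $T\in\mathbb{Z}$, to the Cauchy problem for the discrete nonlinear wave equation $$\frac{\psi_X^{T+1}-2\psi_X^T+\psi_X^{T-1}}{\tau^2}=\sum_{j=1}^n\frac{\psi_{X+e_j}^T-2\psi_X^T+\psi_{X-e_j}^T}{\varepsilon^2}-B_X(|\psi_X^{T+1}|^2,|\psi_X^{T-1}|^2)\,(\psi_X^{T+1}+\psi_X^{T-1}),\qquad (X,T)\in\mathbb{Z}^n\times\mathbb{Z},$$ with the values of $\psi^T$ at $T=0$ and $T=1$ equal to the given $\psi^0$ and $\psi^1$. Moreover, if $(\psi^0,\psi^1)\in l^2(\mathbb{Z}^n)\times l^2(\mathbb{Z}^n)$, then $\psi^T\in l^2(\mathbb{Z}^n)$ for all $T\in\mathbb{Z}$.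
   Context: The unknown is a function $\psi:\mathbb{Z}^n\times\mathbb{Z}\to\mathbb{C}^N$, $(X,T)\mapsto\psi_X^T$; $\psi^T$ denotes the function $X\mapsto\psi_X^T$ on $\mathbb{Z}^n$. A global solution satisfies the equation at every $(X,T)\in\mathbb{Z}^n\times\mathbb{Z}$. Here $e_1,\dots,e_n$ is the standard basis of $\mathbb{Z}^n$, $|\psi|^2=\bar\psi\cdot\psi$ for $\psi\in\mathbb{C}^N$, and $l^2(\mathbb{Z}^n)$ is the space of square-summable $\mathbb{C}^N$-valued functions on $\mathbb{Z}^n$. For $X\in\mathbb{Z}^n$ and $\lambda,\mu\in\mathbb{R}$, $$B_X(\lambda,\mu)=\frac{V_X(\lambda)-V_X(\mu)}{\lambda-\mu}\ \text{ if }\lambda\ne\mu,\qquad B_X(\lambda,\lambda)=\partial_\lambda V_X(\lambda).$$ *)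

theory Defs
  imports "HOL-Analysis.Analysis"
begin

text \<open>
  A lattice point is \<open>X :: int ^ 'n\<close>, with \<open>axis j 1\<close> the standard basis vector \<open>e\<^sub>j\<close>,
  and \<open>\<psi> T X\<close> stands for \<open>\<psi>\<^sub>X\<^sup>T\<close>. Since index types are nonempty, the dimensions
  of \<open>int ^ 'n\<close> and \<open>complex ^ 'N\<close> are at least 1.
\<close>

definition C2 :: "(real \<Rightarrow> real) \<Rightarrow> bool" where
  "C2 f \<longleftrightarrow> (\<forall>x. f differentiable (at x)) \<and> (\<forall>x. deriv f differentiable (at x)) \<and>
     continuous_on UNIV (deriv (deriv f))"

text \<open>The infimum is taken in the extended reals, so it is \<open>-\<infinity>\<close> for a family not bounded below.\<close>

definition k1 :: "(int ^ 'n \<Rightarrow> real \<Rightarrow> real) \<Rightarrow> ereal" where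
  "k1 V = (INF (X, r) \<in> UNIV \<times> {0..}. ereal (deriv (V X) r))"

text \<open>Only meaningful when \<open>k1 V > -\<infinity>\<close>: there \<open>real_of_ereal\<close> does not lose information.\<close>

definition tau1 :: "(int ^ 'n \<Rightarrow> real \<Rightarrow> real) \<Rightarrow> ereal" where
  "tau1 V = (if k1 V < 0 then ereal (sqrt (- 1 / real_of_ereal (k1 V))) else \<infinity>)"

definition B :: "(int ^ 'n \<Rightarrow> real \<Rightarrow> real) \<Rightarrow> int ^ 'n \<Rightarrow> real \<Rightarrow> real \<Rightarrow> real" where
  "B V X r s = (if r \<noteq> s then (V X r - V X s) / (r - s) else deriv (V X) r)"

definition global_solution ::
  "(int ^ 'n \<Rightarrow> real \<Rightarrow> real) \<Rightarrow> real \<Rightarrow> real \<Rightarrow> (int \<Rightarrow> int ^ 'n \<Rightarrow> complex ^ 'N) \<Rightarrow> bool" where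
  "global_solution V \<tau> \<epsilon> \<psi> \<longleftrightarrow> (\<forall>X T.
     (\<psi> (T + 1) X - 2 *\<^sub>R \<psi> T X + \<psi> (T - 1) X) /\<^sub>R \<tau>\<^sup>2 =
     (\<Sum>j\<in>UNIV. (\<psi> T (X + axis j 1) - 2 *\<^sub>R \<psi> T X + \<psi> T (X - axis j 1)) /\<^sub>R \<epsilon>\<^sup>2)
     - B V X ((norm (\<psi> (T + 1) X))\<^sup>2) ((norm (\<psi> (T - 1) X))\<^sup>2) *\<^sub>R (\<psi> (T + 1) X + \<psi> (T - 1) X))"

definition l2 :: "(int ^ 'n \<Rightarrow> complex ^ 'N) set" where
  "l2 = {\<phi>. (\<lambda>X. (norm (\<phi> X))\<^sup>2) summable_on UNIV}"

end

theory Submission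
  imports Defs
begin

text \<open>
  In terms of \<open>s = \<psi>\<^sup>T\<^sup>+\<^sup>1 + \<psi>\<^sup>T\<^sup>-\<^sup>1\<close> the equation at a point reads \<open>(1 + \<tau>\<^sup>2 B) s = \<xi>\<close>, where \<open>\<xi>\<close>
  depends only on \<open>\<psi>\<^sup>T\<close>. By the mean value theorem and the choice of \<open>\<tau>\<close>, the factor
  \<open>1 + \<tau>\<^sup>2 B\<close> is at least some \<open>c > 0\<close>, so a solution \<open>s\<close> on the ray through \<open>\<xi>\<close> exists by the
  intermediate value theorem, and \<open>|s| \<le> |\<xi>| / c\<close> propagates square summability. The equation is
  symmetric in \<open>\<psi>\<^sup>T\<^sup>+\<^sup>1\<close> and \<open>\<psi>\<^sup>T\<^sup>-\<^sup>1\<close>, so the same argument runs backwards in time.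
\<close>

section \<open>The difference quotient \<open>B\<close>: symmetry, bounds, continuity\<close>

lemma C2_has_deriv:
  assumes "C2 f"
  shows "(f has_real_derivative deriv f x) (at x)"
  using assms unfolding C2_def
  by (metis DERIV_deriv_iff_real_differentiable)

lemma C2_isCont: "C2 f \<Longrightarrow> isCont f x"
  using C2_has_deriv DERIV_isCont by blast

lemma B_commute: "B V X r s = B V X s r"
  using minus_divide_divide[of "V X r - V X s" "r - s"] by (simp add: B_def)

text \<open>The intermediate point lies between \<open>r\<close> and \<open>s\<close>, hence in the
  half-line over which the infimum \<open>k1 V\<close> is taken.\<close>

lemma B_eq_deriv:
  assumes "C2 (V X)" "0 \<le> r" "0 \<le> s"
  obtains z where "0 \<le> z" "B V X r s = deriv (V X) z"
proof -
  have mvt: "\<exists>z\<ge>0. B V X r s = deriv (V X) z" if "0 \<le> s" "s < r" for r s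
  proof -
    obtain z where z: "s < z" "z < r" "V X r - V X s = (r - s) * deriv (V X) z"
      using MVT2[OF \<open>s < r\<close>, of "V X" "deriv (V X)"] C2_has_deriv[OF assms(1)] by blast
    then have "B V X r s = deriv (V X) z"
      using that by (simp add: B_def)
    then show ?thesis
      using z that by (intro exI[of _ z]) auto
  qed
  consider "s < r" | "r < s" | "r = s"
    by linarith
  then show ?thesis
  proof cases
    case 1
    then show ?thesis using mvt[of s r] assms that by blast
  next
    case 2
    then show ?thesis using mvt[of r s] assms that B_commute[of V X r s] by auto
  next
    case 3
    then show ?thesis using assms that[of r] by (simp add: B_def)
  qed
qed

text \<open>If \<open>k1 V\<close> is negative, the bound on \<tau> says exactly that
  \<open>1 + \<tau>\<^sup>2 * k1 V\<close> is positive, and this number serves as \<open>c\<close>;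
  otherwise \<open>c = 1\<close> does. That \<open>c\<close> is the same at all lattice points is
  what later gives square summability.\<close>

lemma factor_bounded_below:
  assumes C2: "\<And>X. C2 (V X)"
    and k1: "k1 V > - \<infinity>"
    and tau: "0 < \<tau>" "ereal \<tau> < tau1 V"
  obtains c where "0 < c" "\<And>X r s. 0 \<le> r \<Longrightarrow> 0 \<le> s \<Longrightarrow> c \<le> 1 + \<tau>\<^sup>2 * B V X r s"
proof -
  have k1_le: "k1 V \<le> ereal (deriv (V X) z)" if "0 \<le> z" for X z
    unfolding k1_def using that by (intro INF_lower2[of "(X, z)"]) auto
  have "\<exists>c>0. \<forall>X. \<forall>z\<ge>0. c \<le> 1 + \<tau>\<^sup>2 * deriv (V X) z"
  proof (cases "k1 V < 0")
    case True
    then obtain k where k: "k1 V = ereal k" "k < 0"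
      using k1 by (cases "k1 V") auto
    have "\<tau> < sqrt (- 1 / k)"
      using tau(2) k by (simp add: tau1_def)
    then have "\<tau>\<^sup>2 < - 1 / k"
      using tau(1) real_sqrt_less_iff[of "\<tau>\<^sup>2"] by simp
    then have pos: "0 < 1 + \<tau>\<^sup>2 * k"
      using k(2) by (simp add: field_simps)
    have "1 + \<tau>\<^sup>2 * k \<le> 1 + \<tau>\<^sup>2 * deriv (V X) z" if "0 \<le> z" for X z
      using k1_le[OF that, of X] unfolding k(1) by (intro add_left_mono mult_left_mono) auto
    with pos show ?thesis by blast
  next
    case False
    have "0 \<le> deriv (V X) z" if "0 \<le> z" for X z
      using order_trans[OF leI[OF False] k1_le[OF that, of X]] by simp
    then show ?thesis
      by (intro exI[of _ 1]) auto
  qed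
  then obtain c where c: "0 < c" "\<And>X z. 0 \<le> z \<Longrightarrow> c \<le> 1 + \<tau>\<^sup>2 * deriv (V X) z"
    by blast
  show ?thesis
  proof (rule that[OF c(1)])
    show "c \<le> 1 + \<tau>\<^sup>2 * B V X r s" if rs: "0 \<le> r" "0 \<le> s" for X r s
    proof -
      obtain z where "0 \<le> z" "B V X r s = deriv (V X) z"
        by (rule B_eq_deriv[OF C2 rs])
      then show ?thesis
        using c(2)[of z X] by simp
    qed
  qed
qed

text \<open>On the diagonal this is the definition of the derivative; off it, \<open>B\<close>
  agrees with the plain quotient in a neighbourhood of \<open>r\<close>.\<close>

lemma isCont_B:
  assumes "C2 (V X)"
  shows "isCont (\<lambda>r. B V X r s) r"
proof (cases "r = s")
  case True
  have "((\<lambda>r. (V X r - V X s) / (r - s)) \<longlongrightarrow> deriv (V X) s) (at s)"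
    using C2_has_deriv[OF assms, of s] by (simp add: has_field_derivative_iff)
  then have "((\<lambda>r. B V X r s) \<longlongrightarrow> deriv (V X) s) (at s)"
    by (rule Lim_transform_eventually) (auto simp: eventually_at_filter B_def)
  then show ?thesis
    using True by (simp add: isCont_def B_def)
next
  case False
  have "isCont (\<lambda>r. (V X r - V X s) / (r - s)) r"
    using False C2_isCont[OF assms] by (intro continuous_intros) auto
  moreover have "eventually (\<lambda>r. (V X r - V X s) / (r - s) = B V X r s) (nhds r)"
    using False by (intro eventually_mono[OF t1_space_nhds[of r s]]) (auto simp: B_def)
  ultimately show ?thesis
    using isCont_cong by fast
qed

text \<open>The ansatz \<open>u = t *\<^sub>R \<xi> - v\<close> makes both sides multiples of
  \<open>\<xi>\<close>, so it suffices to solve the scalar equation \<open>f t = 1\<close>.\<close>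

lemma ex_scaled_solution:
  fixes v \<xi> :: "complex ^ 'N"
  assumes C2: "C2 (V X)"
    and c: "0 < c" "\<And>r s. 0 \<le> r \<Longrightarrow> 0 \<le> s \<Longrightarrow> c \<le> 1 + \<tau>\<^sup>2 * B V X r s"
  shows "\<exists>u. (1 + \<tau>\<^sup>2 * B V X ((norm u)\<^sup>2) ((norm v)\<^sup>2)) *\<^sub>R (u + v) = \<xi>"
proof -
  define f where "f t = (1 + \<tau>\<^sup>2 * B V X ((norm (t *\<^sub>R \<xi> - v))\<^sup>2) ((norm v)\<^sup>2)) * t" for t
  have "isCont f t" for t
  proof -
    have "isCont (\<lambda>t. B V X ((norm (t *\<^sub>R \<xi> - v))\<^sup>2) ((norm v)\<^sup>2)) t"
      by (rule isCont_o2[where g = "\<lambda>r. B V X r ((norm v)\<^sup>2)", OF _ isCont_B[of V X, OF C2]])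
        (intro continuous_intros)
    then show ?thesis
      unfolding f_def by (intro continuous_intros)
  qed
  moreover have "f 0 \<le> 1"
    by (simp add: f_def)
  \<comment> \<open>The first factor of \<open>f\<close> is at least \<open>c\<close>, whatever its
    arguments.\<close>
  moreover have "1 \<le> f (1 / c)"
    using c by (simp add: f_def)
  ultimately obtain t where t: "f t = 1"
    using IVT[of f 0 1 "1 / c"] c(1) by auto
  have "(1 + \<tau>\<^sup>2 * B V X ((norm (t *\<^sub>R \<xi> - v))\<^sup>2) ((norm v)\<^sup>2)) *\<^sub>R ((t *\<^sub>R \<xi> - v) + v) = f t *\<^sub>R \<xi>"
    by (simp add: f_def)
  then show ?thesis
    using t by (metis scaleR_one)
qed

section \<open>The equation in solved form and its orbits in time\<close>

definition source :: "real \<Rightarrow> real \<Rightarrow> (int ^ 'n \<Rightarrow> complex ^ 'N) \<Rightarrow> int ^ 'n \<Rightarrow> complex ^ 'N" where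
  "source \<tau> \<epsilon> b X = 2 *\<^sub>R b X +
     (\<tau>\<^sup>2 / \<epsilon>\<^sup>2) *\<^sub>R (\<Sum>j\<in>UNIV. b (X + axis j 1) - 2 *\<^sub>R b X + b (X - axis j 1))"

lemma global_solution_iff:
  assumes "0 < \<tau>"
  shows "global_solution V \<tau> \<epsilon> \<psi> \<longleftrightarrow> (\<forall>T X.
    (1 + \<tau>\<^sup>2 * B V X ((norm (\<psi> (T + 1) X))\<^sup>2) ((norm (\<psi> (T - 1) X))\<^sup>2)) *\<^sub>R
      (\<psi> (T + 1) X + \<psi> (T - 1) X) = source \<tau> \<epsilon> (\<psi> T) X)"
proof -
  have eq: "(u - 2 *\<^sub>R w + v) /\<^sub>R \<tau>\<^sup>2 = S /\<^sub>R \<epsilon>\<^sup>2 - \<beta> *\<^sub>R (u + v) \<longleftrightarrow>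
      (1 + \<tau>\<^sup>2 * \<beta>) *\<^sub>R (u + v) = 2 *\<^sub>R w + (\<tau>\<^sup>2 / \<epsilon>\<^sup>2) *\<^sub>R S" for u v w S :: "complex ^ 'N" and \<beta>
  proof -
    have "(u - 2 *\<^sub>R w + v) /\<^sub>R \<tau>\<^sup>2 = S /\<^sub>R \<epsilon>\<^sup>2 - \<beta> *\<^sub>R (u + v) \<longleftrightarrow>
        \<tau>\<^sup>2 *\<^sub>R ((u - 2 *\<^sub>R w + v) /\<^sub>R \<tau>\<^sup>2) = \<tau>\<^sup>2 *\<^sub>R (S /\<^sub>R \<epsilon>\<^sup>2 - \<beta> *\<^sub>R (u + v))"
      using assms by (metis scaleR_cancel_left zero_less_power less_irrefl)
    also have "\<dots> \<longleftrightarrow> u - 2 *\<^sub>R w + v = (\<tau>\<^sup>2 / \<epsilon>\<^sup>2) *\<^sub>R S - (\<tau>\<^sup>2 * \<beta>) *\<^sub>R (u + v)"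
      using assms by (simp add: scaleR_diff_right divide_inverse)
    also have "\<dots> \<longleftrightarrow> (1 + \<tau>\<^sup>2 * \<beta>) *\<^sub>R (u + v) = 2 *\<^sub>R w + (\<tau>\<^sup>2 / \<epsilon>\<^sup>2) *\<^sub>R S"
      by (auto simp: scaleR_add_left algebra_simps)
    finally show ?thesis .
  qed
  show ?thesis
    unfolding global_solution_def source_def
    by (subst scaleR_sum_right[symmetric], subst eq) blast
qed

text \<open>By \<open>sym\<close>, a forward orbit read backwards is again an orbit. So the past is
  the forward orbit that starts from the swapped data \<open>y\<close>, \<open>x\<close>.\<close>

lemma ex_two_sided_orbit:
  fixes x y :: 'a
  assumes ex: "\<And>a b. \<exists>c. R a b c"
    and sym: "\<And>a b c. R a b c \<Longrightarrow> R c b a"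
  shows "\<exists>\<psi> :: int \<Rightarrow> 'a. (\<forall>T. R (\<psi> (T - 1)) (\<psi> T) (\<psi> (T + 1))) \<and> \<psi> 0 = x \<and> \<psi> 1 = y"
proof -
  obtain g where g: "\<And>a b. R a b (g a b)"
    using ex by metis
  \<comment> \<open>The iteration runs on pairs of consecutive terms; \<open>p a b k\<close> is term
    number \<open>k\<close> of the sequence starting \<open>a\<close>, \<open>b\<close>.\<close>
  define p where "p a b k = fst (((\<lambda>(a, b). (b, g a b)) ^^ k) (a, b))" for a b k
  have snd_eq: "snd (((\<lambda>(a, b). (b, g a b)) ^^ k) (a, b)) = p a b (Suc k)" for a b k
    by (simp add: p_def split: prod.split)
  have p_Suc_Suc: "p a b (Suc (Suc k)) = g (p a b k) (p a b (Suc k))" for a b k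
    unfolding snd_eq[symmetric] by (simp add: p_def split: prod.split)
  have p_0: "p a b 0 = a" and p_1: "p a b (Suc 0) = b" for a b
    by (simp_all add: p_def)
  have orbit: "R (p a b k) (p a b (Suc k)) (p a b (Suc (Suc k)))" for a b k
    unfolding p_Suc_Suc by (rule g)
  define \<psi> where "\<psi> T = (if 0 \<le> T then p x y (nat T) else p y x (nat (1 - T)))" for T
  \<comment> \<open>Both branches agree at times 0 and 1. This overlap puts every triple centred at
    \<open>T \<le> 0\<close> inside the backward orbit, and every triple centred at
    \<open>T \<ge> 1\<close> inside the forward one.\<close>
  have \<psi>_le: "\<psi> T = p y x (nat (1 - T))" if "T \<le> 1" for T
    using that by (cases "T = 1"; cases "T = 0") (auto simp: \<psi>_def p_0 p_1)
  have "R (\<psi> (T - 1)) (\<psi> T) (\<psi> (T + 1))" for T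
  proof (cases "1 \<le> T")
    case True
    define k where "k = nat (T - 1)"
    have "nat T = Suc k" "nat (T + 1) = Suc (Suc k)" "nat (T - 1) = k"
      using True by (auto simp: k_def)
    then show ?thesis
      using True orbit[of x y k] by (simp add: \<psi>_def)
  next
    case False
    define k where "k = nat (- T)"
    have "nat (1 - (T + 1)) = k" "nat (1 - T) = Suc k" "nat (1 - (T - 1)) = Suc (Suc k)"
      using False by (auto simp: k_def)
    then show ?thesis
      using False sym[OF orbit[of y x k]] \<psi>_le[of "T + 1"] \<psi>_le[of T] \<psi>_le[of "T - 1"] by simp
  qed
  moreover have "\<psi> 0 = x" "\<psi> 1 = y"
    by (simp_all add: \<psi>_def p_0 p_1)
  ultimately show ?thesis
    by blast
qed

section \<open>Closure properties of square-summable functions\<close>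

lemma l2_dominated:
  assumes "a \<in> l2" "\<And>X. norm (b X) \<le> C * norm (a X)"
  shows "b \<in> l2"
proof -
  have "(\<lambda>X. C\<^sup>2 * (norm (a X))\<^sup>2) summable_on UNIV"
    using assms(1) by (intro summable_on_cmult_right) (simp add: l2_def)
  moreover have "(norm (b X))\<^sup>2 \<le> C\<^sup>2 * (norm (a X))\<^sup>2" for X
    using power_mono[OF assms(2)[of X], of 2] by (simp add: power_mult_distrib)
  ultimately have "(\<lambda>X. (norm (b X))\<^sup>2) summable_on UNIV"
    by (rule summable_on_comparison_test) auto
  then show ?thesis
    by (simp add: l2_def)
qed

lemma l2_scaleR: "a \<in> l2 \<Longrightarrow> (\<lambda>X. r *\<^sub>R a X) \<in> l2"
  by (rule l2_dominated[where C = "\<bar>r\<bar>"]) auto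

lemma l2_add:
  assumes "a \<in> l2" "b \<in> l2"
  shows "(\<lambda>X. a X + b X) \<in> l2"
proof -
  have "(\<lambda>X. 2 * (norm (a X))\<^sup>2 + 2 * (norm (b X))\<^sup>2) summable_on UNIV"
    using assms by (intro summable_on_add summable_on_cmult_right) (simp_all add: l2_def)
  moreover have "(norm (a X + b X))\<^sup>2 \<le> 2 * (norm (a X))\<^sup>2 + 2 * (norm (b X))\<^sup>2" for X
  proof -
    have "(norm (a X + b X))\<^sup>2 \<le> (norm (a X) + norm (b X))\<^sup>2"
      by (intro power_mono norm_triangle_ineq) simp
    also have "\<dots> \<le> 2 * (norm (a X))\<^sup>2 + 2 * (norm (b X))\<^sup>2"
      using sum_squares_bound[of "norm (a X)" "norm (b X)"] by (simp add: power2_sum)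
    finally show ?thesis .
  qed
  ultimately have "(\<lambda>X. (norm (a X + b X))\<^sup>2) summable_on UNIV"
    by (rule summable_on_comparison_test) auto
  then show ?thesis
    by (simp add: l2_def)
qed

lemma l2_diff: "a \<in> l2 \<Longrightarrow> b \<in> l2 \<Longrightarrow> (\<lambda>X. a X - b X) \<in> l2"
  using l2_add[OF _ l2_scaleR[of b "- 1"]] by simp

lemma l2_sum:
  assumes "finite J" "\<And>j. j \<in> J \<Longrightarrow> a j \<in> l2"
  shows "(\<lambda>X. \<Sum>j\<in>J. a j X) \<in> l2"
  using assms by (induction J) (simp_all add: l2_add, simp add: l2_def)

lemma l2_translate:
  assumes "a \<in> l2"
  shows "(\<lambda>X. a (X + Y)) \<in> l2"
proof -
  have "bij (\<lambda>X. X + Y)"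
    by (rule bij_betw_byWitness[where f' = "\<lambda>X. X - Y"]) auto
  from summable_on_reindex_bij_betw[OF this, of "\<lambda>X. (norm (a X))\<^sup>2"] assms show ?thesis
    by (simp add: l2_def)
qed

lemma l2_source:
  assumes "b \<in> l2"
  shows "source \<tau> \<epsilon> b \<in> l2"
proof -
  have "(\<lambda>X. b (X - Y)) \<in> l2" for Y
    using l2_translate[OF assms, of "- Y"] by simp
  then have "(\<lambda>X. source \<tau> \<epsilon> b X) \<in> l2"
    unfolding source_def using assms
    by (intro l2_add l2_diff l2_scaleR l2_sum l2_translate) auto
  then show ?thesis
    by simp
qed

theorem theorem2p3:
  fixes V :: "int ^ 'n \<Rightarrow> real \<Rightarrow> real"
    and \<psi>0 \<psi>1 :: "int ^ 'n \<Rightarrow> complex ^ 'N"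
    and \<tau> \<epsilon> :: real
  assumes "\<And>X. C2 (V X)"
    and "k1 V > - \<infinity>"
    and "0 < \<tau>" and "ereal \<tau> < tau1 V"
    and "\<epsilon> > 0"
  shows "\<exists>\<psi> :: int \<Rightarrow> int ^ 'n \<Rightarrow> complex ^ 'N.
    global_solution V \<tau> \<epsilon> \<psi> \<and> \<psi> 0 = \<psi>0 \<and> \<psi> 1 = \<psi>1 \<and>
    (\<psi>0 \<in> l2 \<and> \<psi>1 \<in> l2 \<longrightarrow> (\<forall>T. \<psi> T \<in> l2))"
proof -
  obtain c where c: "0 < c" "\<And>X r s. 0 \<le> r \<Longrightarrow> 0 \<le> s \<Longrightarrow> c \<le> 1 + \<tau>\<^sup>2 * B V X r s"
    by (rule factor_bounded_below[OF assms(1-4)]) blast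
  \<comment> \<open>The arguments are the slices at times \<open>T - 1\<close>, \<open>T\<close> and
    \<open>T + 1\<close>.\<close>
  define R where "R a b d \<longleftrightarrow> (\<forall>X. (1 + \<tau>\<^sup>2 * B V X ((norm (d X))\<^sup>2) ((norm (a X))\<^sup>2)) *\<^sub>R
      (d X + a X) = source \<tau> \<epsilon> b X)" for a b d :: "int ^ 'n \<Rightarrow> complex ^ 'N"
  have sym: "R a b d \<Longrightarrow> R d b a" for a b d
    unfolding R_def by (simp add: B_commute[of V] add.commute)
  have ex: "\<exists>d. R a b d" for a b
  proof -
    \<comment> \<open>The unknown slice enters the equation at \<open>X\<close> only through its
      value at \<open>X\<close>, so the lattice points decouple.\<close>
    have "\<forall>X. \<exists>u. (1 + \<tau>\<^sup>2 * B V X ((norm u)\<^sup>2) ((norm (a X))\<^sup>2)) *\<^sub>R (u + a X) = source \<tau> \<epsilon> b X"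
      by (intro allI ex_scaled_solution[OF assms(1) c])
    then show ?thesis
      unfolding R_def by (rule choice)
  qed
  \<comment> \<open>The lower bound \<open>c\<close> controls the sum \<open>d X + a X\<close> by
    the source; subtracting the known slice \<open>a\<close> then leaves \<open>d\<close>.\<close>
  have l2_next: "d \<in> l2" if "R a b d" "a \<in> l2" "b \<in> l2" for a b d
  proof -
    have "norm (d X + a X) \<le> 1 / c * norm (source \<tau> \<epsilon> b X)" for X
    proof -
      let ?q = "1 + \<tau>\<^sup>2 * B V X ((norm (d X))\<^sup>2) ((norm (a X))\<^sup>2)"
      have "c * norm (d X + a X) \<le> \<bar>?q\<bar> * norm (d X + a X)"
        using c(2)[of "(norm (d X))\<^sup>2" "(norm (a X))\<^sup>2" X] by (intro mult_right_mono) auto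
      also have "\<dots> = norm (source \<tau> \<epsilon> b X)"
        using that(1) unfolding R_def by (metis norm_scaleR)
      finally show ?thesis
        using c(1) by (simp add: field_simps)
    qed
    then have "(\<lambda>X. d X + a X) \<in> l2"
      by (rule l2_dominated[OF l2_source[OF that(3)]])
    from l2_diff[OF this that(2)] show ?thesis
      by simp
  qed
  have "\<exists>\<psi>. (\<forall>T :: int. R (\<psi> (T - 1)) (\<psi> T) (\<psi> (T + 1))) \<and> \<psi> 0 = \<psi>0 \<and> \<psi> 1 = \<psi>1"
    by (rule ex_two_sided_orbit[OF ex]) (rule sym)
  then obtain \<psi> where \<psi>: "\<And>T :: int. R (\<psi> (T - 1)) (\<psi> T) (\<psi> (T + 1))" "\<psi> 0 = \<psi>0" "\<psi> 1 = \<psi>1"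
    by blast
  have "global_solution V \<tau> \<epsilon> \<psi>"
    unfolding global_solution_iff[OF assms(3)] using \<psi>(1)[unfolded R_def] by blast
  moreover have "\<psi> T \<in> l2" if init: "\<psi>0 \<in> l2" "\<psi>1 \<in> l2" for T
  proof -
    \<comment> \<open>The equation is of second order in time, so the induction must carry two
      consecutive slices.\<close>
    have "\<psi> T \<in> l2 \<and> \<psi> (T + 1) \<in> l2"
    proof (induction T rule: int_induct[where k = 0])
      case base
      then show ?case using \<psi> init by simp
    next
      case (step1 T)
      then show ?case using l2_next[OF \<psi>(1)[of "T + 1"]] by simp
    next
      case (step2 T)
      \<comment> \<open>After \<open>sym\<close>, the slices at \<open>T + 1\<close> and
        \<open>T\<close> are the known ones and the slice at \<open>T - 1\<close> is the
        next.\<close>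
      then show ?case using l2_next[OF sym[OF \<psi>(1)[of T]]] by simp
    qed
    then show ?thesis ..
  qed
  ultimately show ?thesis
    using \<psi>(2,3) by (intro exI[of _ \<psi>]) blast
qed

end
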